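(* Let $n \geq 3$. Then (1) $cp_n(\emptyset) = 2^{n-1}$; (2) $cp_n(\{i\}) = 2^{n-2}(2^{i-2}-1)$ for every $i \in [3,n]$; (3) $cp_n(\{i,j\}) = 2^{n-3}(2^{i-2}-1)(2^{j-i-1}-1) + 2^{n+j-i-5}\cdot 3\,(3^{i-2}-2^{i-1}+1)$ for all $i,j\in[3,n]$ with $i<j$.
   Context: For integers $a \le b$, $[a,b]=\{a,a+1,\dots,b\}$, $[a,b]=\emptyset$ if $a>b$, and $[n]=[1,n]$. $\mathfrak{S}_n$ is the set of permutations of $[n]$, written in one-line form $\sigma=(\sigma(1)\cdots\sigma(n))$. The circular peak set of $\sigma\in\mathfrak{S}_n$ is $CP(\sigma)=\{\sigma(i) : 2\le i\le n-1,\ \sigma(i-1)<\sigma(i)>\sigma(i+1)\}$. For $S\subseteq[n]$, $CP_n(S)=\{\sigma\in\mathfrak{S}_n : CP(\sigma)=S\}$ and $cp_n(S)=|CP_n(S)|$. *)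

theory Defs
  imports Complex_Main "HOL-Combinatorics.Permutations"
begin

text \<open>
  A permutation of \<open>[n]\<close> is a function \<open>\<sigma>\<close> with \<open>\<sigma> permutes {1..n}\<close>, that is, a bijection of
  \<open>{1..n}\<close> extended by the identity; its one-line form is \<open>\<sigma> 1, \<dots>, \<sigma> n\<close>.
  Note that the circular peak set collects the peak values \<open>\<sigma> i\<close>, not the positions \<open>i\<close>.
\<close>

definition circular_peaks :: "nat \<Rightarrow> (nat \<Rightarrow> nat) \<Rightarrow> nat set" where
  "circular_peaks n \<sigma> = {\<sigma> i | i. 2 \<le> i \<and> i \<le> n - 1 \<and> \<sigma> (i - 1) < \<sigma> i \<and> \<sigma> i > \<sigma> (i + 1)}"

definition CP :: "nat \<Rightarrow> nat set \<Rightarrow> (nat \<Rightarrow> nat) set" where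
  "CP n S = {\<sigma>. \<sigma> permutes {1..n} \<and> circular_peaks n \<sigma> = S}"

definition cp :: "nat \<Rightarrow> nat set \<Rightarrow> nat" where
  "cp n S = card (CP n S)"

end

theory Submission
  imports Defs
begin

text \<open>
  Build permutations of \<open>[n + 1]\<close> by inserting the value \<open>n + 1\<close> into the one-line form of a
  permutation of \<open>[n]\<close>. At either end this leaves the circular peak set unchanged; in an inner gap
  it makes \<open>n + 1\<close> a peak and destroys a peak adjacent to the gap. A permutation with \<open>k\<close> peaks has
  exactly \<open>2 k\<close> gaps adjacent to a peak, because two peaks are never neighbours. Hence
  \<open>cp (n + 1) S = 2 cp n S\<close> if \<open>n + 1\<close> is not in \<open>S\<close>, and
  \<open>cp (n + 1) (T \<union> {n + 1}) = (n - 1 - 2 |T|) cp n T + 2 (\<Sum>v\<in>[n] - T. cp n (T \<union> {v}))\<close>.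
  The three formulas follow from this recurrence by induction on \<open>n\<close>.
\<close>

section \<open>Inserting the largest value\<close>

text \<open>
  The permutation \<open>\<sigma> \<circ> insert_cycle n p\<close> has the one-line form of \<open>\<sigma>\<close>
  with \<open>Suc n\<close> inserted at position \<open>p\<close>.
\<close>
definition insert_cycle :: "nat \<Rightarrow> nat \<Rightarrow> nat \<Rightarrow> nat" where
  "insert_cycle n p x =
     (if x = p then Suc n else if p < x \<and> x \<le> Suc n then x - 1 else x)"

lemma insert_cycle_permutes:
  assumes "p \<in> {1..Suc n}"
  shows "insert_cycle n p permutes {1..Suc n}"
proof (rule bij_imp_permutes)
  have "inj_on (insert_cycle n p) {1..Suc n}"
    using assms by (auto simp: inj_on_def insert_cycle_def split: if_splits)
  moreover have "insert_cycle n p ` {1..Suc n} \<subseteq> {1..Suc n}"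
    using assms by (auto simp: insert_cycle_def)
  ultimately show "bij_betw (insert_cycle n p) {1..Suc n} {1..Suc n}"
    by (simp add: bij_betw_def endo_inj_surj)
qed (use assms in \<open>auto simp: insert_cycle_def\<close>)

lemma permutes_comp_insert_cycle:
  assumes "\<sigma> permutes {1..n}" "p \<in> {1..Suc n}"
  shows "\<sigma> \<circ> insert_cycle n p permutes {1..Suc n}"
proof -
  have "\<sigma> permutes {1..Suc n}"
    using assms(1) by (rule permutes_subset) auto
  then show ?thesis
    using insert_cycle_permutes[OF assms(2)] by (intro permutes_compose)
qed

text \<open>The position \<open>p\<close> is recovered as the place of the value
  \<open>Suc n\<close>, and cancelling \<open>insert_cycle n p\<close> then recovers the
  permutation. Surjectivity follows by counting: n! * (n + 1) = (n + 1)!.\<close>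

lemma bij_betw_insert_max:
  "bij_betw (\<lambda>(\<sigma>, p). \<sigma> \<circ> insert_cycle n p)
     ({\<sigma>. \<sigma> permutes {1..n}} \<times> {1..Suc n}) {\<tau>. \<tau> permutes {1..Suc n}}"
  (is "bij_betw ?f ?A ?B")
proof -
  have inj: "inj_on ?f ?A"
  proof (rule inj_onI, clarify)
    fix \<sigma> p \<tau> q
    assume \<sigma>: "\<sigma> permutes {1..n}" and \<tau>: "\<tau> permutes {1..n}"
      and p: "p \<in> {1..Suc n}" and q: "q \<in> {1..Suc n}"
      and eq: "\<sigma> \<circ> insert_cycle n p = \<tau> \<circ> insert_cycle n q"
    have fix_max: "\<sigma> (Suc n) = Suc n" "\<tau> (Suc n) = Suc n"
      using permutes_not_in[OF \<sigma>] permutes_not_in[OF \<tau>] by auto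
    have "\<tau> (insert_cycle n q p) = \<tau> (Suc n)"
      using fun_cong[OF eq, of p] fix_max by (simp add: insert_cycle_def)
    then have "insert_cycle n q p = Suc n"
      by (rule injD[OF permutes_inj[OF \<tau>]])
    then have pq: "p = q"
      using p q by (auto simp: insert_cycle_def split: if_splits)
    have "surj (insert_cycle n q)"
      using permutes_surj[OF insert_cycle_permutes[OF q]] .
    have "\<sigma> x = \<tau> x" for x
    proof -
      obtain y where "x = insert_cycle n q y"
        using surjD[OF \<open>surj (insert_cycle n q)\<close>] by blast
      then show ?thesis using fun_cong[OF eq, of y] pq by simp
    qed
    then have "\<sigma> = \<tau>" by (rule ext)
    then show "\<sigma> = \<tau> \<and> p = q" using pq by simp
  qed
  have "?f ` ?A = ?B"
  proof (rule card_subset_eq)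
    show "finite ?B" by (simp add: finite_permutations)
    show "?f ` ?A \<subseteq> ?B" using permutes_comp_insert_cycle by auto
    have "card ?A = fact n * Suc n"
      by (simp add: card_cartesian_product card_permutations)
    also have "\<dots> = card ?B"
      by (simp add: card_permutations)
    finally show "card (?f ` ?A) = card ?B"
      using card_image[OF inj] by simp
  qed
  with inj show ?thesis by (simp add: bij_betw_def)
qed

section \<open>Effect of an insertion on the circular peak set\<close>

text \<open>Being next to a gap is a condition on positions, whereas \<open>circular_peaks\<close>
  records values; injectivity translates between the two.\<close>

definition peak_positions :: "nat \<Rightarrow> (nat \<Rightarrow> nat) \<Rightarrow> nat set" where
  "peak_positions n \<sigma> = {i. 2 \<le> i \<and> i \<le> n - 1 \<and> \<sigma> (i - 1) < \<sigma> i \<and> \<sigma> i > \<sigma> (i + 1)}"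

lemma circular_peaks_eq_image: "circular_peaks n \<sigma> = \<sigma> ` peak_positions n \<sigma>"
  by (auto simp: circular_peaks_def peak_positions_def)

lemma finite_peak_positions [simp]: "finite (peak_positions n \<sigma>)"
  by (rule finite_subset[of _ "{..n}"]) (auto simp: peak_positions_def)

lemma mem_circular_peaks_iff:
  assumes "\<sigma> permutes {1..n}"
  shows "\<sigma> i \<in> circular_peaks n \<sigma> \<longleftrightarrow> i \<in> peak_positions n \<sigma>"
  using permutes_inj[OF assms] by (auto simp: circular_peaks_eq_image inj_def)

text \<open>A peak exceeds two distinct values, each at least 1.\<close>

lemma circular_peaks_subset:
  assumes "\<sigma> permutes {1..n}"
  shows "circular_peaks n \<sigma> \<subseteq> {3..n}"
proof
  fix v assume "v \<in> circular_peaks n \<sigma>"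
  then obtain i where i: "v = \<sigma> i" "2 \<le> i" "i \<le> n - 1" "\<sigma> (i - 1) < \<sigma> i" "\<sigma> (i + 1) < \<sigma> i"
    by (auto simp: circular_peaks_def)
  have mem: "\<sigma> (i - 1) \<in> {1..n}" "\<sigma> i \<in> {1..n}" "\<sigma> (i + 1) \<in> {1..n}"
    unfolding permutes_in_image[OF assms] using i by auto
  have "\<sigma> (i - 1) \<noteq> \<sigma> (i + 1)"
    using permutes_inj[OF assms] by (auto simp: inj_eq)
  then show "v \<in> {3..n}" using i mem by auto
qed

text \<open>A maximum at an end is not an inner entry, and the former end entry beside it is
  smaller, so no peak appears or vanishes.\<close>

lemma circular_peaks_insert_end:
  assumes \<sigma>: "\<sigma> permutes {1..n}" and "n \<ge> 1"
  shows "circular_peaks (Suc n) (\<sigma> \<circ> insert_cycle n (Suc n)) = circular_peaks n \<sigma>"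
    and "circular_peaks (Suc n) (\<sigma> \<circ> insert_cycle n 1) = circular_peaks n \<sigma>"
proof -
  have fix_max: "\<sigma> (Suc n) = Suc n" using permutes_not_in[OF \<sigma>] by auto
  have le: "\<sigma> x \<le> n" if "1 \<le> x" "x \<le> n" for x
    using permutes_in_image[OF \<sigma>, of x] that by auto
  show "circular_peaks (Suc n) (\<sigma> \<circ> insert_cycle n (Suc n)) = circular_peaks n \<sigma>"
  proof -
    have "peak_positions (Suc n) (\<sigma> \<circ> insert_cycle n (Suc n)) = peak_positions n \<sigma>"
    proof (rule set_eqI)
      fix i
      show "i \<in> peak_positions (Suc n) (\<sigma> \<circ> insert_cycle n (Suc n)) \<longleftrightarrow> i \<in> peak_positions n \<sigma>"
        using fix_max le[of i] by (cases "i = n") (auto simp: peak_positions_def insert_cycle_def)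
    qed
    then show ?thesis
      unfolding circular_peaks_eq_image
      by (intro image_cong) (auto simp: insert_cycle_def peak_positions_def)
  qed
  show "circular_peaks (Suc n) (\<sigma> \<circ> insert_cycle n 1) = circular_peaks n \<sigma>"
  proof -
    have "peak_positions (Suc n) (\<sigma> \<circ> insert_cycle n 1) = Suc ` peak_positions n \<sigma>"
    proof (rule set_eqI)
      fix i
      show "i \<in> peak_positions (Suc n) (\<sigma> \<circ> insert_cycle n 1)
        \<longleftrightarrow> i \<in> Suc ` peak_positions n \<sigma>"
      proof (cases "i \<le> 2")
        case True
        then show ?thesis
          using fix_max le[of 1] \<open>n \<ge> 1\<close>
          by (cases "i = 2") (auto simp: peak_positions_def insert_cycle_def)
      next
        case False
        then obtain k where "i = Suc k" "k \<ge> 2" by (cases i) auto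
        then show ?thesis
          by (auto simp: peak_positions_def insert_cycle_def)
      qed
    qed
    then have "circular_peaks (Suc n) (\<sigma> \<circ> insert_cycle n 1)
        = (\<lambda>i. (\<sigma> \<circ> insert_cycle n 1) (Suc i)) ` peak_positions n \<sigma>"
      by (simp only: circular_peaks_eq_image image_image)
    also have "\<dots> = circular_peaks n \<sigma>"
      unfolding circular_peaks_eq_image
      by (intro image_cong) (auto simp: insert_cycle_def peak_positions_def)
    finally show ?thesis .
  qed
qed

text \<open>Both neighbours of \<open>Suc n\<close> are smaller, so it is a peak and they are not.
  Every other entry keeps its neighbours; those right of the gap move by one position.\<close>

lemma circular_peaks_insert_inner:
  assumes \<sigma>: "\<sigma> permutes {1..n}" and p: "2 \<le> p" "p \<le> n"
  shows "circular_peaks (Suc n) (\<sigma> \<circ> insert_cycle n p)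
    = insert (Suc n) (circular_peaks n \<sigma> - {\<sigma> (p - 1), \<sigma> p})"
proof -
  let ?P = "peak_positions n \<sigma>"
  define \<tau> where "\<tau> = \<sigma> \<circ> insert_cycle n p"
  have fix_max: "\<sigma> (Suc n) = Suc n" using permutes_not_in[OF \<sigma>] by auto
  have le: "\<sigma> x \<le> n" if "1 \<le> x" "x \<le> n" for x
    using permutes_in_image[OF \<sigma>, of x] that by auto
  have lo: "\<tau> x = \<sigma> x" if "x < p" for x
    using that by (simp add: \<tau>_def insert_cycle_def)
  have mid: "\<tau> p = Suc n"
    using fix_max by (simp add: \<tau>_def insert_cycle_def)
  have hi: "\<tau> (Suc x) = \<sigma> x" if "p \<le> x" "x \<le> n" for x
    using that by (simp add: \<tau>_def insert_cycle_def)
  have pos: "peak_positions (Suc n) \<tau>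
    = insert p ({i \<in> ?P. i < p - 1} \<union> Suc ` {i \<in> ?P. p < i})" (is "?L = ?R")
  proof (rule set_eqI)
    fix i
    consider "i < p - 1" | "i = p - 1" | "i = p" | "i = Suc p" | "i > Suc p"
      by linarith
    then show "i \<in> ?L \<longleftrightarrow> i \<in> ?R"
    proof cases
      case 1
      then show ?thesis
        using p lo[of i] lo[of "i - 1"] lo[of "i + 1"] by (auto simp: peak_positions_def)
    next
      case 2
      then show ?thesis
        using p lo[of i] mid le[of i] by (auto simp: peak_positions_def)
    next
      case 3
      then show ?thesis
        using p lo[of "p - 1"] mid hi[of p] le[of p] le[of "p - 1"]
        by (auto simp: peak_positions_def less_Suc_eq_le)
    next
      case 4
      then show ?thesis
        using p mid hi[of p] le[of p] by (auto simp: peak_positions_def)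
    next
      case 5
      then obtain k where "i = Suc k" "p < k" by (cases i) auto
      then show ?thesis
        using p hi[of "k - 1"] hi[of k] hi[of "Suc k"]
        by (auto simp: peak_positions_def)
    qed
  qed
  \<comment> \<open>This bound supplies the condition \<open>x \<le> n\<close> of
    \<open>hi\<close>.\<close>
  have "?P \<subseteq> {..n}" by (auto simp: peak_positions_def)
  then have "circular_peaks (Suc n) \<tau>
    = insert (Suc n) (\<sigma> ` {i \<in> ?P. i < p - 1} \<union> \<sigma> ` {i \<in> ?P. p < i})"
    unfolding circular_peaks_eq_image pos image_insert image_Un image_image mid
    using lo hi by (intro arg_cong2[of _ _ _ _ insert] arg_cong2[of _ _ _ _ "(\<union>)"] image_cong)
      (auto)
  also have "\<sigma> ` {i \<in> ?P. i < p - 1} \<union> \<sigma> ` {i \<in> ?P. p < i} = \<sigma> ` (?P - {p - 1, p})"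
    unfolding image_Un[symmetric] using p by (intro arg_cong2[of _ _ _ _ "(`)"]) auto
  also have "\<dots> = circular_peaks n \<sigma> - {\<sigma> (p - 1), \<sigma> p}"
    using permutes_inj[OF \<sigma>] by (simp add: circular_peaks_eq_image image_set_diff)
  finally show ?thesis unfolding \<tau>_def .
qed

section \<open>The recurrence\<close>

lemma cp_eq_0:
  assumes "\<not> S \<subseteq> {3..n}"
  shows "cp n S = 0"
proof -
  have "CP n S = {}" using assms circular_peaks_subset by (auto simp: CP_def)
  then show ?thesis by (simp add: cp_def)
qed

text \<open>The indicator form permits reindexing along \<open>bij_betw_insert_max\<close>.\<close>

lemma cp_eq_sum:
  "cp n S = (\<Sum>\<sigma> | \<sigma> permutes {1..n}. if circular_peaks n \<sigma> = S then 1 else 0)"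
  by (simp add: cp_def CP_def sum.If_cases finite_permutations Collect_conj_eq)

lemma cp_Suc_eq_sum:
  "cp (Suc n) S = (\<Sum>\<sigma> | \<sigma> permutes {1..n}.
     card {p \<in> {1..Suc n}. circular_peaks (Suc n) (\<sigma> \<circ> insert_cycle n p) = S})"
proof -
  let ?f = "\<lambda>\<tau>. if circular_peaks (Suc n) \<tau> = S then 1 else 0 :: nat"
  have "cp (Suc n) S = (\<Sum>x \<in> {\<sigma>. \<sigma> permutes {1..n}} \<times> {1..Suc n}.
      ?f ((\<lambda>(\<sigma>, p). \<sigma> \<circ> insert_cycle n p) x))"
    unfolding cp_eq_sum by (rule sum.reindex_bij_betw[OF bij_betw_insert_max, symmetric])
  also have "\<dots> = (\<Sum>\<sigma> | \<sigma> permutes {1..n}. \<Sum>p\<in>{1..Suc n}. ?f (\<sigma> \<circ> insert_cycle n p))"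
    unfolding sum.cartesian_product by (simp only: case_prod_unfold)
  also have "\<dots> = (\<Sum>\<sigma> | \<sigma> permutes {1..n}.
     card {p \<in> {1..Suc n}. circular_peaks (Suc n) (\<sigma> \<circ> insert_cycle n p) = S})"
    by (intro sum.cong refl) (simp only: card_eq_sum sum.inter_filter finite_atLeastAtMost)
  finally show ?thesis .
qed

text \<open>An inner insertion makes \<open>Suc n\<close> a peak, so only the two end positions
  count, and both preserve the peak set.\<close>

lemma cp_Suc_same:
  assumes "n \<ge> 1" "Suc n \<notin> S"
  shows "cp (Suc n) S = 2 * cp n S"
proof -
  have "card {p \<in> {1..Suc n}. circular_peaks (Suc n) (\<sigma> \<circ> insert_cycle n p) = S}
    = 2 * (if circular_peaks n \<sigma> = S then 1 else 0)" if \<sigma>: "\<sigma> permutes {1..n}" for \<sigma>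
  proof -
    have "{p \<in> {1..Suc n}. circular_peaks (Suc n) (\<sigma> \<circ> insert_cycle n p) = S}
      = (if circular_peaks n \<sigma> = S then {1, Suc n} else {})" (is "?L = ?R")
    proof (rule set_eqI)
      fix p
      consider "p = 0 \<or> p > Suc n" | "p = 1" | "p = Suc n" | "2 \<le> p" "p \<le> n" by linarith
      then show "p \<in> ?L \<longleftrightarrow> p \<in> ?R"
        using circular_peaks_insert_end[OF \<sigma> \<open>n \<ge> 1\<close>] circular_peaks_insert_inner[OF \<sigma>, of p]
          \<open>Suc n \<notin> S\<close> by cases auto
    qed
    then show ?thesis using \<open>n \<ge> 1\<close> by simp
  qed
  then show ?thesis
    unfolding cp_Suc_eq_sum cp_eq_sum[of n] sum_distrib_left by (intro sum.cong) auto
qed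

section \<open>Counting the inner gaps that leave a prescribed peak set\<close>

text \<open>A peak at \<open>q\<close> excludes the gaps \<open>q\<close> and \<open>Suc q\<close>.
  Peaks are never adjacent, so the excluded gaps are all distinct.\<close>

lemma card_gaps_avoiding_peaks:
  assumes \<sigma>: "\<sigma> permutes {1..n}" and "n \<ge> 1"
  shows "int (card {p \<in> {2..n}. p - 1 \<notin> peak_positions n \<sigma> \<and> p \<notin> peak_positions n \<sigma>})
    = int n - 1 - 2 * int (card (circular_peaks n \<sigma>))"
proof -
  let ?P = "peak_positions n \<sigma>"
  have sub: "?P \<union> Suc ` ?P \<subseteq> {2..n}" by (auto simp: peak_positions_def)
  have "?P \<inter> Suc ` ?P = {}" by (auto simp: peak_positions_def)
  then have 1: "card (?P \<union> Suc ` ?P) = 2 * card ?P"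
    by (simp add: card_Un_disjoint card_image)
  have 2: "card (circular_peaks n \<sigma>) = card ?P"
    unfolding circular_peaks_eq_image
    by (rule card_image) (rule inj_on_subset[OF permutes_inj[OF \<sigma>]], simp)
  have "p \<in> Suc ` ?P \<longleftrightarrow> p - 1 \<in> ?P" if "p \<ge> 2" for p
    using that by (cases p) auto
  then have "{p \<in> {2..n}. p - 1 \<notin> ?P \<and> p \<notin> ?P} = {2..n} - (?P \<union> Suc ` ?P)" by auto
  moreover have "card ({2..n} - (?P \<union> Suc ` ?P)) = (n - 1) - 2 * card ?P"
    using 1 by (subst card_Diff_subset[OF _ sub]) auto
  \<comment> \<open>With this bound the natural-number subtraction is exact and passes to the
    integers.\<close>
  moreover have "2 * card ?P \<le> n - 1"
    using card_mono[OF _ sub] 1 by simp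
  ultimately show ?thesis using 2 \<open>n \<ge> 1\<close> by auto
qed

text \<open>An inner insertion destroys at most one old peak, so \<open>T\<close> remains only if
  the old peak set is \<open>T\<close>, with a gap away from all peaks, or
  \<open>insert v T\<close>, with one of the two gaps beside \<open>v\<close>.\<close>

lemma card_inner_insertions:
  assumes \<sigma>: "\<sigma> permutes {1..n}" and "n \<ge> 1"
  shows "int (card {p \<in> {2..n}. circular_peaks n \<sigma> - {\<sigma> (p - 1), \<sigma> p} = T})
    = (int n - 1 - 2 * int (card T)) * (if circular_peaks n \<sigma> = T then 1 else 0)
      + (\<Sum>v\<in>{1..n} - T. 2 * (if circular_peaks n \<sigma> = insert v T then 1 else 0))"
    (is "int (card ?G) = _ + (\<Sum>v\<in>_. 2 * ?h v)")
proof -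
  let ?C = "circular_peaks n \<sigma>" and ?P = "peak_positions n \<sigma>"
  note mem = mem_circular_peaks_iff[OF \<sigma>]
  consider "?C = T" | v where "v \<notin> T" "?C = insert v T"
    | "?C \<noteq> T" "\<And>v. v \<notin> T \<Longrightarrow> ?C \<noteq> insert v T" by blast
  then show ?thesis
  proof cases
    case 1
    then have "?G = {p \<in> {2..n}. p - 1 \<notin> ?P \<and> p \<notin> ?P}"
      using mem by blast
    moreover have "(\<Sum>v\<in>{1..n} - T. 2 * ?h v) = (0::int)"
      using 1 by (intro sum.neutral) auto
    ultimately show ?thesis
      using 1 card_gaps_avoiding_peaks[OF assms] by simp
  next
    case (2 v)
    then obtain q where q: "v = \<sigma> q" "q \<in> ?P"
      by (auto simp: circular_peaks_eq_image)
    have adj: "Suc q \<notin> ?P" "q - 1 \<notin> ?P" "2 \<le> q" "q \<le> n - 1"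
      using q by (auto simp: peak_positions_def)
    have T: "T = ?C - {\<sigma> q}" using 2 q by blast
    \<comment> \<open>The gap must touch the lost peak; its other neighbour is not a peak, so
      nothing else is lost.\<close>
    have "?G = {q, Suc q}"
    proof (intro equalityI subsetI)
      fix p assume "p \<in> ?G"
      then have "p \<ge> 2" "v = \<sigma> (p - 1) \<or> v = \<sigma> p" using 2 by auto
      then have "q = p - 1 \<or> q = p"
        using q permutes_inj[OF \<sigma>] by (auto simp: inj_eq)
      then show "p \<in> {q, Suc q}" using \<open>p \<ge> 2\<close> by auto
    next
      fix p assume "p \<in> {q, Suc q}"
      then have "?C - {\<sigma> (p - 1), \<sigma> p} = ?C - {\<sigma> q}" and "p \<in> {2..n}"
        using adj mem[of "Suc q"] mem[of "q - 1"] by auto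
      then show "p \<in> ?G" using T by blast
    qed
    moreover have "v \<in> {1..n} - T"
      using 2 circular_peaks_subset[OF \<sigma>] by auto
    moreover have "?h w = (if w = v then 1 else 0 :: int)" if "w \<in> {1..n} - T" for w
      using 2 that by auto
    ultimately show ?thesis using 2
      by (auto simp: sum.delta if_distrib[of "(*) _"] cong: if_cong)
  next
    case 3
    have "?G = {}"
    proof (rule equals0I)
      fix p assume p: "p \<in> ?G"
      then have T: "T = ?C - {\<sigma> (p - 1), \<sigma> p}" and "p \<ge> 2" by auto
      \<comment> \<open>Adjacent positions cannot both be peaks, so at most one peak is
        removed.\<close>
      have "p - 1 \<notin> ?P \<or> p \<notin> ?P"
        using \<open>p \<ge> 2\<close> by (auto simp: peak_positions_def)
      then have "\<sigma> (p - 1) \<notin> ?C \<or> \<sigma> p \<notin> ?C" using mem by blast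
      then have "?C = T \<or> ?C = insert (\<sigma> (p - 1)) T \<or> ?C = insert (\<sigma> p) T"
        using T by blast
      then show False using 3 T by blast
    qed
    moreover have "(\<Sum>v\<in>{1..n} - T. 2 * ?h v) = (0::int)"
      using 3 by (intro sum.neutral) auto
    ultimately show ?thesis using 3 by simp
  qed
qed

text \<open>Summing \<open>card_inner_insertions\<close> over all permutations gives the recurrence.
  It is stated over the integers because the factor of \<open>cp n T\<close> can be negative when
  \<open>cp n T\<close> is zero.\<close>

lemma cp_Suc_insert:
  assumes "n \<ge> 1" "Suc n \<notin> T"
  shows "int (cp (Suc n) (insert (Suc n) T)) = (int n - 1 - 2 * int (card T)) * int (cp n T)
    + 2 * (\<Sum>v\<in>{1..n} - T. int (cp n (insert v T)))"
proof -
  let ?S = "insert (Suc n) T" and ?Q = "{\<sigma>. \<sigma> permutes {1..n}}"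
  have ind: "int (cp n S) = (\<Sum>\<sigma>\<in>?Q. if circular_peaks n \<sigma> = S then 1 else 0)" for S
    unfolding cp_eq_sum by (simp add: if_distrib cong: if_cong)
  have "{p \<in> {1..Suc n}. circular_peaks (Suc n) (\<sigma> \<circ> insert_cycle n p) = ?S}
    = {p \<in> {2..n}. circular_peaks n \<sigma> - {\<sigma> (p - 1), \<sigma> p} = T}" (is "?L = ?R")
    if \<sigma>: "\<sigma> permutes {1..n}" for \<sigma>
  proof (rule set_eqI)
    fix p
    have nin: "Suc n \<notin> circular_peaks n \<sigma>"
      using circular_peaks_subset[OF \<sigma>] by auto
    consider "p \<notin> {1..Suc n}" | "p \<in> {1, Suc n}" | "2 \<le> p" "p \<le> n" by force
    then show "p \<in> ?L \<longleftrightarrow> p \<in> ?R"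
    proof cases
      case 1
      then show ?thesis by auto
    next
      case 2
      then have "circular_peaks (Suc n) (\<sigma> \<circ> insert_cycle n p) = circular_peaks n \<sigma>"
        using circular_peaks_insert_end[OF \<sigma> \<open>n \<ge> 1\<close>] by blast
      then have "circular_peaks (Suc n) (\<sigma> \<circ> insert_cycle n p) \<noteq> ?S" using nin by blast
      moreover have "p \<notin> {2..n}" using 2 by auto
      ultimately show ?thesis by blast
    next
      case 3
      then show ?thesis
        using circular_peaks_insert_inner[OF \<sigma> 3] nin \<open>Suc n \<notin> T\<close>
        by (simp add: insert_ident)
    qed
  qed
  then have "int (cp (Suc n) ?S) = (\<Sum>\<sigma>\<in>?Q.
      int (card {p \<in> {2..n}. circular_peaks n \<sigma> - {\<sigma> (p - 1), \<sigma> p} = T}))"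
    unfolding cp_Suc_eq_sum of_nat_sum by (intro sum.cong) auto
  also have "\<dots> = (\<Sum>\<sigma>\<in>?Q.
      (int n - 1 - 2 * int (card T)) * (if circular_peaks n \<sigma> = T then 1 else 0)
      + (\<Sum>v\<in>{1..n} - T. 2 * (if circular_peaks n \<sigma> = insert v T then 1 else 0)))"
    using card_inner_insertions[OF _ \<open>n \<ge> 1\<close>] by (intro sum.cong) auto
  also have "\<dots> = (int n - 1 - 2 * int (card T)) * int (cp n T)
    + (\<Sum>v\<in>{1..n} - T. 2 * int (cp n (insert v T)))"
    unfolding sum.distrib ind sum_distrib_left by (subst (2) sum.swap) simp
  finally show ?thesis by (simp add: sum_distrib_left)
qed

text \<open>The values 1 and 2 are never peaks, so their terms vanish.\<close>

lemma cp_Suc_insert_values: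
  assumes "n \<ge> 1" "Suc n \<notin> T"
  shows "int (cp (Suc n) (insert (Suc n) T)) = (int n - 1 - 2 * int (card T)) * int (cp n T)
    + 2 * (\<Sum>v\<in>{3..n} - T. int (cp n (insert v T)))"
proof -
  have "(\<Sum>v\<in>{1..n} - T. int (cp n (insert v T))) = (\<Sum>v\<in>{3..n} - T. int (cp n (insert v T)))"
    by (rule sum.mono_neutral_right) (auto intro!: cp_eq_0)
  then show ?thesis using cp_Suc_insert[OF assms] by simp
qed

section \<open>Solving the recurrence\<close>

lemma cp_empty:
  assumes "n \<ge> 1"
  shows "cp n {} = 2 ^ (n - 1)"
  using assms
proof (induction n rule: dec_induct)
  case base
  have "CP 1 {} = {id}" by (auto simp: CP_def circular_peaks_def)
  then show ?case by (simp add: cp_def)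
next
  case (step n)
  then show ?case using cp_Suc_same[of n "{}"] by (cases n) auto
qed

lemma sum_two_powers_minus_one:
  assumes "n \<ge> 2"
  shows "(\<Sum>v=3..n. 2 ^ (v - 2) - 1 :: int) = 2 ^ (n - 1) - int n"
  using assms
proof (induction n rule: dec_induct)
  case (step n)
  then obtain m where "n = m + 2" by (metis add.commute le_Suc_ex)
  with step show ?case by simp
qed simp

text \<open>For \<open>i \<le> n\<close> the count doubles. For \<open>i = Suc n\<close> the
  recurrence with empty \<open>T\<close> leaves a geometric sum.\<close>

lemma cp_singleton:
  assumes "n \<ge> 2" "i \<in> {3..n}"
  shows "int (cp n {i}) = 2 ^ (n - 2) * (2 ^ (i - 2) - 1)"
  using assms
proof (induction n arbitrary: i rule: dec_induct)
  case base
  then show ?case by simp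
next
  case (step n)
  then obtain m where m: "n = m + 2" by (metis add.commute le_Suc_ex)
  show ?case
  proof (cases "i = Suc n")
    case False
    then show ?thesis
      using step cp_Suc_same[of n "{i}"] m by auto
  next
    case True
    have "int (cp (Suc n) {Suc n}) = (int n - 1) * 2 ^ (n - 1)
      + 2 * (\<Sum>v=3..n. 2 ^ (n - 2) * (2 ^ (v - 2) - 1))"
      using cp_Suc_insert_values[of n "{}"] step cp_empty[of n] by simp
    then show ?thesis
      unfolding sum_distrib_left[symmetric] sum_two_powers_minus_one[OF step.hyps(1)]
      using True m by (simp add: algebra_simps)
  qed
qed

text \<open>
  The formula for \<open>cp n {i, j}\<close> divided by \<open>2 ^ (n - 4)\<close>, with \<open>a = i - 2\<close> and \<open>d = j - i - 1\<close>;
  in these coordinates no truncated subtraction occurs.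
\<close>
definition pair_weight :: "nat \<Rightarrow> nat \<Rightarrow> int" where
  "pair_weight a d = 2 * (2 ^ a - 1) * (2 ^ d - 1) + 3 * 2 ^ d * (3 ^ a - 2 * 2 ^ a + 1)"

section \<open>Summation identities for the pair weights\<close>

lemma pair_weight_0 [simp]: "pair_weight 0 d = 0"
  by (simp add: pair_weight_def)

lemma pair_weight_Suc: "pair_weight a (Suc d) = 2 * pair_weight a d + 2 * (2 ^ a - 1)"
  by (simp add: pair_weight_def algebra_simps)

text \<open>This sums over pairs with a fixed larger element. \<open>pair_weight_Suc\<close> carries
  one antidiagonal to the next, whose extra term has \<open>d = 0\<close>.\<close>

lemma sum_pair_weight_antidiagonal:
  "(\<Sum>a<Suc A. pair_weight a (A - a))
     = 3 * (3 ^ Suc A - 2 * 2 ^ Suc A + 1) - 2 * int A * (2 ^ Suc A - 1)"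
proof (induction A)
  case 0
  show ?case by simp
next
  case (Suc A)
  have "(\<Sum>a<Suc A. pair_weight a (Suc A - a))
    = (\<Sum>a<Suc A. 2 * pair_weight a (A - a) + 2 * (2 ^ a - 1))"
    by (intro sum.cong) (auto simp: Suc_diff_le pair_weight_Suc)
  also have "\<dots> = 2 * (\<Sum>a<Suc A. pair_weight a (A - a)) + 2 * (\<Sum>a<Suc A. 2 ^ a - 1)"
    by (simp add: sum.distrib sum_distrib_left)
  also have "(\<Sum>a<Suc A. 2 ^ a - 1 :: int) = 2 ^ Suc A - int A - 2"
    by (induction A) auto
  finally show ?case
    unfolding Suc.IH sum.lessThan_Suc[of _ "Suc A"]
    by (simp add: pair_weight_def algebra_simps)
qed

text \<open>This sums over pairs with a fixed smaller element.\<close>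

lemma sum_pair_weight_row:
  "(\<Sum>e<d. pair_weight a e)
     = 2 * (2 ^ a - 1) * (2 ^ d - 1 - int d) + 3 * (2 ^ d - 1) * (3 ^ a - 2 * 2 ^ a + 1)"
  by (induction d) (auto simp: pair_weight_def algebra_simps)

text \<open>The factor 16 clears the denominator of \<open>2 ^ (n - 4)\<close>. If the larger
  element is at most \<open>n\<close>, the count doubles; if it is \<open>Suc n\<close>, the
  recurrence applies with \<open>T\<close> the singleton of the smaller one.\<close>

lemma cp_pair:
  assumes "n \<ge> 3" "A + d + 4 \<le> n"
  shows "16 * int (cp n {A + 3, A + d + 4}) = 2 ^ n * pair_weight (Suc A) d"
  using assms
proof (induction n arbitrary: A d rule: dec_induct)
  case base
  then show ?case by simp
next
  case (step n)
  show ?case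
  proof (cases "A + d + 4 \<le> n")
    case True
    then show ?thesis
      using step cp_Suc_same[of n "{A + 3, A + d + 4}"] by simp
  next
    case False
    then have n: "n = A + d + 3" using step.prems by simp
    let ?i = "A + 3"
    let ?f = "\<lambda>v. 16 * int (cp n {v, ?i})"
    have "(\<lambda>a. a + 3) ` {..<A} = {3..<A + 3}"
      "(\<lambda>e. e + (A + 4)) ` {..<d} = {A + 4..<d + (A + 4)}"
      unfolding lessThan_atLeast0 image_add_atLeastLessThan' by simp_all
    \<comment> \<open>Values below \<open>?i\<close> will give an antidiagonal of weights, values
      above it a row.\<close>
    then have "{3..n} - {?i} = (\<lambda>a. a + 3) ` {..<A} \<union> (\<lambda>e. e + (A + 4)) ` {..<d}"
      using n by auto
    then have "(\<Sum>v\<in>{3..n} - {?i}. ?f v)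
      = (\<Sum>v\<in>(\<lambda>a. a + 3) ` {..<A}. ?f v) + (\<Sum>v\<in>(\<lambda>e. e + (A + 4)) ` {..<d}. ?f v)"
      by (simp only:) (rule sum.union_disjoint, auto)
    also have "\<dots> = (\<Sum>a<A. ?f (a + 3)) + (\<Sum>e<d. ?f (e + (A + 4)))"
      by (simp add: sum.reindex inj_on_def)
    also have "(\<Sum>a<A. ?f (a + 3)) = (\<Sum>a<A. 2 ^ n * pair_weight (Suc a) (A - Suc a))"
    proof (intro sum.cong refl)
      fix a assume "a \<in> {..<A}"
      then have "a + (A - Suc a) + 4 = ?i" by auto
      then show "?f (a + 3) = 2 ^ n * pair_weight (Suc a) (A - Suc a)"
        using step.IH[of a "A - Suc a"] n by (simp add: add.commute)
    qed
    \<comment> \<open>The added term \<open>pair_weight 0 A\<close> is zero; it completes the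
      antidiagonal after an index shift.\<close>
    also have "\<dots> = 2 ^ n * (\<Sum>a<Suc A. pair_weight a (A - a))"
      by (simp add: sum.lessThan_Suc_shift sum_distrib_left del: sum.lessThan_Suc)
    also have "(\<Sum>e<d. ?f (e + (A + 4))) = (\<Sum>e<d. 2 ^ n * pair_weight (Suc A) e)"
      using step.IH[of A] n by (intro sum.cong refl) (simp add: insert_commute add_ac)
    also have "\<dots> = 2 ^ n * (\<Sum>e<d. pair_weight (Suc A) e)"
      by (simp add: sum_distrib_left)
    finally have sum: "(\<Sum>v\<in>{3..n} - {?i}. ?f v)
      = 2 ^ n * ((\<Sum>a<Suc A. pair_weight a (A - a)) + (\<Sum>e<d. pair_weight (Suc A) e))"
      by (simp add: algebra_simps)
    have "16 * int (cp (Suc n) {Suc n, ?i})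
      = (int n - 3) * (16 * int (cp n {?i})) + 2 * (\<Sum>v\<in>{3..n} - {?i}. ?f v)"
      using cp_Suc_insert_values[of n "{?i}"] n by (simp add: sum_distrib_left algebra_simps)
    also have "16 * int (cp n {?i}) = 4 * 2 ^ n * (2 ^ Suc A - 1)"
      using cp_singleton[of n ?i] n by (simp add: power_add algebra_simps)
    also have "(int n - 3) * \<dots> + 2 * (\<Sum>v\<in>{3..n} - {?i}. ?f v)
      = 2 ^ Suc n * pair_weight (Suc A) d"
    proof -
      \<comment> \<open>Since \<open>n - 3 = A + d\<close>, the terms linear in \<open>A\<close> and
        \<open>d\<close> cancel against those of the two closed sums.\<close>
      have "2 * (int n - 3) * (2 ^ Suc A - 1) + ((\<Sum>a<Suc A. pair_weight a (A - a))
          + (\<Sum>e<d. pair_weight (Suc A) e)) = pair_weight (Suc A) d"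
        unfolding sum_pair_weight_antidiagonal sum_pair_weight_row n
        by (simp add: pair_weight_def algebra_simps)
      then show ?thesis
        unfolding sum by (simp only: flip: \<open>_ = pair_weight (Suc A) d\<close>) (simp add: algebra_simps)
    qed
    finally have "16 * int (cp (Suc n) {Suc n, ?i}) = 2 ^ Suc n * pair_weight (Suc A) d" .
    moreover have "Suc n = A + d + 4" using n by simp
    ultimately show ?thesis by (simp only: insert_commute)
  qed
qed

theorem theorem2p1:
  fixes n :: nat
  assumes "n \<ge> 3"
  shows "cp n {} = 2 ^ (n - 1)
    \<and> (\<forall>i\<in>{3..n}. int (cp n {i}) = 2 ^ (n - 2) * (2 ^ (i - 2) - 1))
    \<and> (\<forall>i\<in>{3..n}. \<forall>j\<in>{3..n}. i < j \<longrightarrow>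
         int (cp n {i, j}) =
           2 ^ (n - 3) * (2 ^ (i - 2) - 1) * (2 ^ (j - i - 1) - 1)
           + 2 ^ (n + j - i - 5) * 3 * (3 ^ (i - 2) - 2 ^ (i - 1) + 1))"
proof (intro conjI ballI impI)
  show "cp n {} = 2 ^ (n - 1)" using assms cp_empty by simp
  show "int (cp n {i}) = 2 ^ (n - 2) * (2 ^ (i - 2) - 1)" if "i \<in> {3..n}" for i
    using that assms cp_singleton by simp
next
  fix i j assume ij: "i \<in> {3..n}" "j \<in> {3..n}" "i < j"
  \<comment> \<open>As \<open>3 \<le> i < j \<le> n\<close>, all truncated subtractions are exact in
    these coordinates.\<close>
  define A where "A = i - 3"
  define d where "d = j - i - 1"
  define k where "k = n - 4"
  have eqs: "i = A + 3" "j = A + d + 4" "n = k + 4"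
    using ij by (auto simp: A_def d_def k_def)
  have "16 * int (cp n {i, j}) = 2 ^ n * pair_weight (Suc A) d"
    using cp_pair[of n A d] ij eqs by simp
  then have "int (cp n {i, j}) = 2 ^ k * pair_weight (Suc A) d"
    by (simp add: eqs(3) power_add)
  moreover have "n - 3 = Suc k" "i - 2 = Suc A" "j - i - 1 = d" "n + j - i - 5 = k + d"
    "i - 1 = Suc (Suc A)"
    by (auto simp: eqs)
  ultimately show "int (cp n {i, j}) =
      2 ^ (n - 3) * (2 ^ (i - 2) - 1) * (2 ^ (j - i - 1) - 1)
      + 2 ^ (n + j - i - 5) * 3 * (3 ^ (i - 2) - 2 ^ (i - 1) + 1)"
    by (simp add: pair_weight_def power_add algebra_simps)
qed

end
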